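(* Let $\alpha>0$, let $\Omega\subset\mathbb{R}^n$ be a bounded $\alpha$-asymmetric domain, and let $D\subset\mathbb{R}^n$ be a bounded domain. Let $c_0=c_0(n)$, $r_0=r_0(n,\alpha)$ and $\beta$ be the constants and the function described in the context. Suppose that $\mu_\Omega=C_0\lambda_1(\Omega)$, where $C_0>\frac{c_0}{r_0^2}$ is a constant. Then for every maximizer $\bar x+D$ of $\mu_\Omega$ (that is, every $\bar x\in\mathbb{R}^n$ with $\lambda_1(\Omega\setminus(\bar x+D))=\mu_\Omega$) one has $$\rho_{\bar x}\le\beta^{-1}(C_0),$$ where $\beta^{-1}(C_0)$ is the unique $\rho>0$ with $\beta(\rho)=C_0$. In particular, if $C_0$ is sufficiently large (in terms of $n$ and $\alpha$), then $$\rho_{\bar x}\le \frac{K}{\sqrt{C_0\,\lambda_1(\Omega)}}$$ with a constant $K$ depending only on $n$.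
   Context: A domain is a nonempty connected open set. For $\alpha>0$, a bounded domain $\Omega\subset\mathbb{R}^n$ is called $\alpha$-asymmetric if for all $y\in\partial\Omega$ and all $r>0$, $\frac{|B_r(y)\setminus\Omega|}{|B_r(y)|}\ge\alpha$, where $B_r(y)$ is the ball of radius $r$ centered at $y$ and $|\cdot|$ is Lebesgue measure. $\lambda_1(U)$ denotes the first eigenvalue of $-\Delta$ on $U$ with Dirichlet boundary conditions; for the set $U=\Omega\setminus(x+D)$ this is understood as the infimum of $\int|\nabla u|^2/\int u^2$ over nonzero $u\in C_c^\infty(\operatorname{int}U)$ ($+\infty$ if the interior is empty). $\phi_{\lambda_1(\Omega)}>0$ denotes the first Dirichlet eigenfunction (ground state) of $\Omega$, and $$M:=\{y\in\Omega:\ \phi_{\lambda_1(\Omega)}(y)=\|\phi_{\lambda_1(\Omega)}\|_{L^\infty(\Omega)}\}$$ is its set of maximum points. For $x\in\mathbb{R}^n$, $x+D$ is the translate of the obstacle $D$ by $x$, and $$\rho_x:=\max_{y\in M} d(y,x+D),\qquad \mu_\Omega:=\max_{x\in\mathbb{R}^n}\lambda_1(\Omega\setminus(x+D)),$$ where $d(y,x+D)$ is the Euclidean distance from the point $y$ to the set $x+D$. Constants: $c_0=c_0(n)>0$ and $r_0=r_0(n,\alpha)>0$ are fixed constants with the following property (the paper establishes that such constants exist). Put $\beta_0:=c_0/r_0^2$ and, for a bounded $\alpha$-asymmetric domain $\Omega$, define $\beta:(0,\infty)\to(0,\infty)$ by $\beta(\rho)=\beta_0$ if $\rho\sqrt{\lambda_1(\Omega)}>r_0$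 and $\beta(\rho)=\frac{c_0}{\rho^2\lambda_1(\Omega)}$ if $\rho\sqrt{\lambda_1(\Omega)}\le r_0$. Then for every bounded $\alpha$-asymmetric domain $\Omega\subset\mathbb{R}^n$, every bounded domain $D\subset\mathbb{R}^n$ and every $x\in\mathbb{R}^n$ with $\rho_x>0$, one has $\lambda_1(\Omega\setminus(x+D))\le\beta(\rho_x)\lambda_1(\Omega)$. *)

theory Defs
  imports "HOL-Analysis.Analysis" "HOL-Probability.Essential_Supremum"
begin

definition bounded_domain :: "'a::euclidean_space set \<Rightarrow> bool" where
  "bounded_domain \<Omega> \<longleftrightarrow> \<Omega> \<noteq> {} \<and> open \<Omega> \<and> connected \<Omega> \<and> bounded \<Omega>"

definition asymmetric :: "real \<Rightarrow> 'a::euclidean_space set \<Rightarrow> bool" where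
  "asymmetric \<alpha> \<Omega> \<longleftrightarrow>
     (\<forall>y\<in>frontier \<Omega>. \<forall>r>0.
        measure lebesgue (ball y r - \<Omega>) / measure lebesgue (ball y r) \<ge> \<alpha>)"

definition partial :: "('a::euclidean_space \<Rightarrow> real) \<Rightarrow> 'a \<Rightarrow> 'a \<Rightarrow> real" where
  "partial f i x = frechet_derivative f (at x) i"

definition gradient :: "('a::euclidean_space \<Rightarrow> real) \<Rightarrow> 'a \<Rightarrow> 'a" where
  "gradient f x = (\<Sum>i\<in>Basis. partial f i x *\<^sub>R i)"

definition laplacian :: "('a::euclidean_space \<Rightarrow> real) \<Rightarrow> 'a \<Rightarrow> real" where
  "laplacian f x = (\<Sum>i\<in>Basis. partial (partial f i) i x)"

text \<open>The class of k times continuously differentiable functions on an open set; differentiability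
  is required explicitly because \<^const>\<open>frechet_derivative\<close> is unspecified without it.\<close>

primrec Ck_on :: "nat \<Rightarrow> 'a::euclidean_space set \<Rightarrow> ('a \<Rightarrow> real) \<Rightarrow> bool" where
  "Ck_on 0 S f \<longleftrightarrow> continuous_on S f"
| "Ck_on (Suc k) S f \<longleftrightarrow>
     (\<forall>x\<in>S. f differentiable at x) \<and> (\<forall>i\<in>Basis. Ck_on k S (partial f i))"

text \<open>Smooth functions with compact support in U, extended by zero to the whole space.\<close>

definition test_functions :: "'a::euclidean_space set \<Rightarrow> ('a \<Rightarrow> real) set" where
  "test_functions U =
     {u. (\<forall>k. Ck_on k UNIV u) \<and> compact (closure {x. u x \<noteq> 0}) \<and> closure {x. u x \<noteq> 0} \<subseteq> U}"

text \<open>The infimum over the empty set is \<open>\<infinity>\<close>, which is the value for sets with empty interior.\<close>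

definition lambda1 :: "'a::euclidean_space set \<Rightarrow> ereal" where
  "lambda1 U =
     (INF u \<in> {u \<in> test_functions (interior U). u \<noteq> (\<lambda>_. 0)}.
        ereal ((LINT x|lborel. (norm (gradient u x))\<^sup>2) / (LINT x|lborel. (u x)\<^sup>2)))"

text \<open>Membership in the closure of the test functions in the Sobolev norm, for a function that is
  classically differentiable in \<open>\<Omega>\<close>.  Values outside \<open>\<Omega>\<close> are irrelevant.  Nonnegative integrals are
  used since the Bochner integral of a non-integrable function is 0.\<close>

definition H10 :: "'a::euclidean_space set \<Rightarrow> ('a \<Rightarrow> real) \<Rightarrow> bool" where
  "H10 \<Omega> \<phi> \<longleftrightarrow>
     (\<exists>u. (\<forall>k::nat. u k \<in> test_functions \<Omega>) \<and>
        (\<lambda>k. \<integral>\<^sup>+x\<in>\<Omega>. ennreal ((u k x - \<phi> x)\<^sup>2) \<partial>lborel) \<longlonglongrightarrow> 0 \<and>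
        (\<lambda>k. \<integral>\<^sup>+x\<in>\<Omega>. ennreal ((norm (gradient (u k) x - gradient \<phi> x))\<^sup>2) \<partial>lborel) \<longlonglongrightarrow> 0)"

text \<open>A positive eigenfunction of the Dirichlet Laplacian for the eigenvalue \<^term>\<open>lambda1 \<Omega>\<close>.
  By elliptic regularity weak eigenfunctions are classical solutions in the interior, so the
  equation is stated pointwise; the boundary condition is membership in the Sobolev space.
  The ground state is unique up to a positive factor, on which the set of maximum points does not
  depend.\<close>

definition ground_state :: "'a::euclidean_space set \<Rightarrow> ('a \<Rightarrow> real) \<Rightarrow> bool" where
  "ground_state \<Omega> \<phi> \<longleftrightarrow>
     Ck_on 2 \<Omega> \<phi> \<and> H10 \<Omega> \<phi> \<and> (\<forall>y\<in>\<Omega>. \<phi> y > 0) \<and>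
     (\<forall>y\<in>\<Omega>. ereal (- laplacian \<phi> y) = lambda1 \<Omega> * ereal (\<phi> y))"

definition max_points :: "'a::euclidean_space set \<Rightarrow> ('a \<Rightarrow> real) \<Rightarrow> 'a set" where
  "max_points \<Omega> \<phi> = {y\<in>\<Omega>. ereal (\<phi> y) = esssup (lebesgue_on \<Omega>) (\<lambda>z. ereal \<bar>\<phi> z\<bar>)}"

abbreviation translate :: "'a::euclidean_space \<Rightarrow> 'a set \<Rightarrow> 'a set" where
  "translate x D \<equiv> (\<lambda>y. x + y) ` D"

text \<open>The maxima in the definitions of \<open>\<rho>\<^sub>x\<close> and \<open>\<mu>\<^sub>\<Omega>\<close> are written as suprema.
  For an asymmetric \<open>\<Omega>\<close> the set of maximum points is nonempty and compact, so the first is attained;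
  the second equals the maximum as soon as a maximizer exists.\<close>

definition rho :: "'a::euclidean_space set \<Rightarrow> ('a \<Rightarrow> real) \<Rightarrow> 'a set \<Rightarrow> 'a \<Rightarrow> real" where
  "rho \<Omega> \<phi> D x = (SUP y \<in> max_points \<Omega> \<phi>. infdist y (translate x D))"

definition mu :: "'a::euclidean_space set \<Rightarrow> 'a set \<Rightarrow> ereal" where
  "mu \<Omega> D = (SUP x. lambda1 (\<Omega> - translate x D))"

definition beta :: "real \<Rightarrow> real \<Rightarrow> 'a::euclidean_space set \<Rightarrow> real \<Rightarrow> real" where
  "beta c\<^sub>0 r\<^sub>0 \<Omega> \<rho> =
     (if \<rho> * sqrt (real_of_ereal (lambda1 \<Omega>)) > r\<^sub>0 then c\<^sub>0 / r\<^sub>0\<^sup>2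
      else c\<^sub>0 / (\<rho>\<^sup>2 * real_of_ereal (lambda1 \<Omega>)))"

definition beta_inv :: "real \<Rightarrow> real \<Rightarrow> 'a::euclidean_space set \<Rightarrow> real \<Rightarrow> real" where
  "beta_inv c\<^sub>0 r\<^sub>0 \<Omega> C = (THE \<rho>. \<rho> > 0 \<and> beta c\<^sub>0 r\<^sub>0 \<Omega> \<rho> = C)"

end

theory Submission
  imports Defs
begin

text \<open>A ground state forces \<open>\<lambda>\<^sub>1(\<Omega>)\<close> to be finite, and the Poincare inequality makes it
  positive. The bound on \<open>\<lambda>\<^sub>1(\<Omega> - (x + D))\<close> then reads \<open>C\<^sub>0 \<le> \<beta>(\<rho>\<^sub>x)\<close> at a maximizer. Since
  \<open>C\<^sub>0 > c\<^sub>0/r\<^sub>0\<^sup>2\<close>, this happens on the branch \<open>\<beta>(\<rho>) = c\<^sub>0/(\<rho>\<^sup>2 \<lambda>\<^sub>1(\<Omega>))\<close>, so that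
  \<open>\<rho>\<^sub>x \<le> sqrt (c\<^sub>0 / (C\<^sub>0 \<lambda>\<^sub>1(\<Omega>)))\<close>; the right-hand side is \<open>\<beta>\<^sup>-\<^sup>1(C\<^sub>0)\<close>, and \<open>K = sqrt c\<^sub>0\<close>.

  The Poincare inequality comes from integrating the derivative of \<open>(x \<bullet> i) u\<^sup>2\<close> in a coordinate
  direction \<open>i\<close>.\<close>

section \<open>Integration of compactly supported functions and of their derivatives\<close>

lemma integrable_continuous_bounded_support:
  fixes f :: "'a::euclidean_space \<Rightarrow> real"
  assumes "continuous_on UNIV f" and "\<And>x. x \<notin> cball 0 R \<Longrightarrow> f x = 0"
  shows "integrable lborel f"
proof -
  have "integrable lborel (\<lambda>x. indicator (cball 0 R) x *\<^sub>R f x)"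
    by (rule borel_integrable_compact) (auto intro: continuous_on_subset[OF assms(1)])
  also have "(\<lambda>x. indicator (cball 0 R) x *\<^sub>R f x) = f"
    using assms(2) by (auto simp: fun_eq_iff indicator_def)
  finally show ?thesis .
qed

text \<open>The difference quotients of \<open>f\<close> integrate to 0 by translation invariance, and they converge
  dominatedly to the derivative.\<close>

lemma integral_derivative_eq_0:
  fixes f :: "'a::euclidean_space \<Rightarrow> real"
  assumes deriv: "\<And>x. (f has_derivative f' x) (at x)"
    and cont: "continuous_on UNIV (\<lambda>x. f' x i)"
    and supp: "\<And>x. x \<notin> cball 0 R \<Longrightarrow> f x = 0"
  shows "(LINT x|lborel. f' x i) = 0"
proof -
  have contf: "continuous_on UNIV f"
    by (meson deriv has_derivative_continuous continuous_at_imp_continuous_on)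
  have intf: "integrable lborel f"
    by (rule integrable_continuous_bounded_support[OF contf supp])
  \<comment> \<open>The successor keeps every step positive, since \<open>inverse 0 = 0\<close>.
    That \<open>t k \<le> 1\<close> holds for all \<open>k\<close> is what allows one majorant for
    all difference quotients.\<close>
  define t where "t k = inverse (real (Suc k))" for k
  have t: "t k > 0" "t k \<le> 1" for k
    by (auto simp: t_def field_simps)
  have tlim: "t \<longlonglongrightarrow> 0"
    unfolding t_def by (rule LIMSEQ_inverse_real_of_nat)
  define h where "h k x = (f (t k *\<^sub>R i + x) - f x) / t k" for k x
  have shift_int: "integrable lborel (\<lambda>x. f (c + x))" for c
  proof -
    have "integrable (distr lborel borel ((+) c)) f"
      using intf by (simp add: lborel_distr_plus)
    then show ?thesis by (subst (asm) integrable_distr_eq) (use contf in \<open>auto intro: borel_measurable_continuous_onI\<close>)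
  qed
  have shift_eq: "(LINT x|lborel. f (c + x)) = (LINT x|lborel. f x)" for c
  proof -
    have "(LINT x|lborel. f x) = (LINT x|distr lborel borel ((+) c). f x)"
      by (simp add: lborel_distr_plus)
    also have "\<dots> = (LINT x|lborel. f (c + x))"
      by (subst integral_distr) (use contf in \<open>auto intro: borel_measurable_continuous_onI\<close>)
    finally show ?thesis by simp
  qed
  have h0: "(LINT x|lborel. h k x) = 0" for k
    by (simp add: h_def shift_int intf shift_eq)
  \<comment> \<open>A shift by \<open>t k *\<^sub>R i\<close> moves a point by at most
    \<open>norm i\<close>, so every \<open>h k\<close> vanishes outside the ball of radius
    \<open>S\<close>. For \<open>x\<close> inside it, the segment from \<open>x\<close> to the
    shifted point stays in the ball of radius \<open>S + norm i\<close>, which is why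
    \<open>M\<close> is taken there.\<close>
  define S where "S = R + norm i"
  have "compact ((\<lambda>x. f' x i) ` cball 0 (S + norm i))"
    by (intro compact_continuous_image continuous_on_subset[OF cont]) auto
  then obtain M where "\<forall>y \<in> (\<lambda>x. f' x i) ` cball 0 (S + norm i). norm y \<le> M"
    using compact_imp_bounded bounded_iff by metis
  then have M: "\<And>x. x \<in> cball 0 (S + norm i) \<Longrightarrow> norm (f' x i) \<le> M"
    by blast
  have line_deriv: "((\<lambda>s. f (s *\<^sub>R i + x)) has_field_derivative f' (s *\<^sub>R i + x) i) (at s)" for x s
  proof -
    have "(f \<circ> (\<lambda>s. s *\<^sub>R i + x) has_derivative f' (s *\<^sub>R i + x) \<circ> (\<lambda>r. r *\<^sub>R i)) (at s)"
      by (rule diff_chain_at) (auto intro!: derivative_eq_intros deriv)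
    moreover have "f' (s *\<^sub>R i + x) (r *\<^sub>R i) = f' (s *\<^sub>R i + x) i * r" for r
      by (simp add: linear_scale[OF has_derivative_linear[OF deriv]])
    ultimately show ?thesis by (simp add: o_def has_field_derivative_def)
  qed
  have bound: "norm (h k x) \<le> M * indicator (cball 0 S) x" for k x
  proof (cases "x \<in> cball 0 S")
    case True
    \<comment> \<open>By the mean value theorem along the segment, the difference quotient is a
      value of the directional derivative, to which the bound \<open>M\<close> applies.\<close>
    have "\<exists>s. 0 < s \<and> s < t k \<and> f (t k *\<^sub>R i + x) - f (0 *\<^sub>R i + x)
            = (t k - 0) * f' (s *\<^sub>R i + x) i"
      by (rule MVT2) (use t line_deriv in auto)
    then obtain s where s: "0 < s" "s < t k"
      and "f (t k *\<^sub>R i + x) - f (0 *\<^sub>R i + x) = (t k - 0) * f' (s *\<^sub>R i + x) i"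
      by blast
    then have eq: "f (t k *\<^sub>R i + x) - f x = t k * f' (s *\<^sub>R i + x) i"
      by simp
    have "norm (s *\<^sub>R i + x) \<le> s * norm i + norm x"
      using s norm_triangle_ineq[of "s *\<^sub>R i" x] by simp
    also have "s * norm i \<le> norm i"
      using s t(2)[of k] by (intro mult_left_le_one_le) auto
    finally have "norm (s *\<^sub>R i + x) \<le> norm i + norm x" by simp
    then have "norm (f' (s *\<^sub>R i + x) i) \<le> M"
      using True by (intro M) auto
    moreover have "h k x = f' (s *\<^sub>R i + x) i"
      using eq t(1)[of k] by (simp add: h_def)
    ultimately show ?thesis using True by simp
  next
    case False
    have "norm x \<le> norm (t k *\<^sub>R i + x) + norm (t k *\<^sub>R i)"
      using norm_triangle_ineq4[of "t k *\<^sub>R i + x" "t k *\<^sub>R i"] by simp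
    also have "norm (t k *\<^sub>R i) \<le> norm i"
      using t[of k] by (simp add: mult_left_le_one_le)
    finally have "f (t k *\<^sub>R i + x) = 0"
      using False by (intro supp) (auto simp: S_def)
    moreover have "f x = 0"
      using False norm_ge_zero[of i] by (intro supp) (auto simp: S_def simp del: norm_ge_zero)
    ultimately show ?thesis using False by (simp add: h_def)
  qed
  have lim: "(\<lambda>k. h k x) \<longlonglongrightarrow> f' x i" for x
  proof -
    have "((\<lambda>s. f (s *\<^sub>R i + x)) has_field_derivative f' x i) (at 0)"
      using line_deriv[of x 0] by simp
    then have "((\<lambda>s. (f (s *\<^sub>R i + x) - f x) / s) \<longlongrightarrow> f' x i) (at 0)"
      by (simp add: has_field_derivative_iff)
    moreover have "filterlim t (at 0) sequentially"
      unfolding filterlim_at using tlim t(1) by (auto simp: less_imp_neq[symmetric] intro!: always_eventually)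
    ultimately show ?thesis
      unfolding h_def by (rule filterlim_compose)
  qed
  have "(\<lambda>k. LINT x|lborel. h k x) \<longlonglongrightarrow> (LINT x|lborel. f' x i)"
  proof (rule integral_dominated_convergence)
    show "integrable lborel (\<lambda>x. M * indicator (cball 0 S) x)"
      by (intro integrable_mult_right) (simp add: integrable_indicator_iff emeasure_bounded_finite[simplified])
    show "(\<lambda>x. f' x i) \<in> borel_measurable lborel"
      using cont by (simp add: borel_measurable_continuous_onI)
    show "h k \<in> borel_measurable lborel" for k
      unfolding h_def using shift_int[THEN borel_measurable_integrable] intf[THEN borel_measurable_integrable]
      by measurable
  qed (use lim bound in auto)
  then show ?thesis
    by (simp add: h0 LIMSEQ_const_iff)
qed

section \<open>Test functions and the Poincare inequality\<close>

lemma test_function_properties: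
  fixes u :: "'a::euclidean_space \<Rightarrow> real"
  assumes "u \<in> test_functions U"
  shows "(u has_derivative frechet_derivative u (at x)) (at x)"
    and "continuous_on UNIV u"
    and "i \<in> Basis \<Longrightarrow> continuous_on UNIV (partial u i)"
    and "x \<notin> U \<Longrightarrow> u x = 0"
    and "x \<notin> U \<Longrightarrow> gradient u x = 0"
proof -
  have "Ck_on (Suc 0) UNIV u"
    using assms unfolding test_functions_def by blast
  then have diff: "\<And>x. u differentiable at x"
    and "\<And>i. i \<in> Basis \<Longrightarrow> continuous_on UNIV (partial u i)"
    by auto
  then show "i \<in> Basis \<Longrightarrow> continuous_on UNIV (partial u i)" by blast
  show "(u has_derivative frechet_derivative u (at x)) (at x)"
    using diff by (simp add: frechet_derivative_works)
  show "continuous_on UNIV u"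
    using diff differentiable_imp_continuous_within continuous_at_imp_continuous_on by blast
  have U: "closure {x. u x \<noteq> 0} \<subseteq> U"
    using assms unfolding test_functions_def by blast
  have "u x = 0" if "x \<notin> closure {x. u x \<noteq> 0}" for x
    using that closure_subset[of "{x. u x \<noteq> 0}"] by blast
  then show "x \<notin> U \<Longrightarrow> u x = 0"
    using U by blast
  assume "x \<notin> U"
  then have x: "x \<in> - closure {x. u x \<noteq> 0}" using U by blast
  \<comment> \<open>The complement of the closed support is an open neighbourhood of
    \<open>x\<close> on which \<open>u\<close> is constantly 0.\<close>
  have "(u has_derivative (\<lambda>_. 0)) (at x)"
    by (rule has_derivative_transform_within_open[OF has_derivative_const[of 0] _ x])
      (use closure_subset[of "{x. u x \<noteq> 0}"] in auto)
  then show "gradient u x = 0"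
    by (simp add: gradient_def partial_def frechet_derivative_at[symmetric])
qed

lemma inner_gradient_Basis:
  "i \<in> Basis \<Longrightarrow> gradient u x \<bullet> i = partial u i x"
  by (simp add: gradient_def inner_sum_left inner_Basis if_distrib cong: if_cong)

lemma poincare_inequality:
  fixes u :: "'a::euclidean_space \<Rightarrow> real"
  assumes u: "u \<in> test_functions U" and U: "U \<subseteq> cball 0 B"
  shows "(LINT x|lborel. (u x)\<^sup>2) \<le> 4 * B\<^sup>2 * (LINT x|lborel. (norm (gradient u x))\<^sup>2)"
proof -
  note props = test_function_properties[OF u]
  have u0: "u x = 0" if "x \<notin> cball 0 B" for x
    using props(4) U that by blast
  have g0: "gradient u x = 0" if "x \<notin> cball 0 B" for x
    using props(5) U that by blast
  obtain i :: 'a where i: "i \<in> Basis" using nonempty_Basis by blast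
  note cont = props(2) props(3)[OF i]
  have contg: "continuous_on UNIV (gradient u)"
    unfolding gradient_def by (intro continuous_intros props(3))
  \<comment> \<open>For \<open>v = i\<close> the factor \<open>v \<bullet> i\<close> is 1, so the
    derivative is the square of \<open>u\<close> plus a cross term. Its integral is 0, which
    expresses the integral of the square by the cross term alone.\<close>
  have "((\<lambda>x. (x \<bullet> i) * (u x)\<^sup>2) has_derivative
      (\<lambda>v. (v \<bullet> i) * (u x)\<^sup>2 + (x \<bullet> i) * (2 * u x * frechet_derivative u (at x) v))) (at x)" for x
    by (rule derivative_eq_intros props(1) refl | simp add: algebra_simps)+
  moreover have "continuous_on UNIV (\<lambda>x. (u x)\<^sup>2 + (x \<bullet> i) * (2 * u x * partial u i x))"
    by (intro continuous_intros cont)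
  ultimately have "(LINT x|lborel. (u x)\<^sup>2 + (x \<bullet> i) * (2 * u x * partial u i x)) = 0"
    using integral_derivative_eq_0[where f = "\<lambda>x. (x \<bullet> i) * (u x)\<^sup>2" and i = i and R = B
        and f' = "\<lambda>x v. (v \<bullet> i) * (u x)\<^sup>2 + (x \<bullet> i) * (2 * u x * frechet_derivative u (at x) v)"] i u0
    by (simp add: partial_def)
  moreover have I1: "integrable lborel (\<lambda>x. (u x)\<^sup>2)"
    by (rule integrable_continuous_bounded_support[where R = B])
      (auto intro!: continuous_intros cont simp: u0)
  moreover have I2: "integrable lborel (\<lambda>x. (x \<bullet> i) * (2 * u x * partial u i x))"
    by (rule integrable_continuous_bounded_support[where R = B])
      (auto intro!: continuous_intros cont simp: u0)
  ultimately have eq: "(LINT x|lborel. (u x)\<^sup>2) = (LINT x|lborel. - ((x \<bullet> i) * (2 * u x * partial u i x)))"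
    by simp
  have I3: "integrable lborel (\<lambda>x. (norm (gradient u x))\<^sup>2)"
    by (rule integrable_continuous_bounded_support[where R = B])
      (auto intro!: continuous_intros contg simp: g0)
  \<comment> \<open>The weights are chosen so that half of the integral of the square of
    \<open>u\<close> can be absorbed on the left; doubling what remains gives the factor
    \<open>4 * B\<^sup>2\<close>.\<close>
  have "(LINT x|lborel. (u x)\<^sup>2)
      \<le> (LINT x|lborel. (u x)\<^sup>2 / 2 + 2 * B\<^sup>2 * (norm (gradient u x))\<^sup>2)"
    unfolding eq
  proof (rule integral_mono)
    fix x
    show "- ((x \<bullet> i) * (2 * u x * partial u i x)) \<le> (u x)\<^sup>2 / 2 + 2 * B\<^sup>2 * (norm (gradient u x))\<^sup>2"
    proof (cases "x \<in> cball 0 B")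
      case True
      have "\<bar>x \<bullet> i\<bar> \<le> B"
        using Basis_le_norm[OF i, of x] True by simp
      moreover have "\<bar>partial u i x\<bar> \<le> norm (gradient u x)"
        using Basis_le_norm[OF i, of "gradient u x"] by (simp add: inner_gradient_Basis i)
      ultimately have "\<bar>(x \<bullet> i) * partial u i x\<bar> \<le> B * norm (gradient u x)"
        unfolding abs_mult by (intro mult_mono) auto
      then have "((x \<bullet> i) * partial u i x)\<^sup>2 \<le> (B * norm (gradient u x))\<^sup>2"
        by (metis abs_ge_zero power2_abs power_mono)
      \<comment> \<open>Twice this expanded square bounds the cross term by
        \<open>(u x)\<^sup>2 / 2\<close> plus twice the square of
        \<open>(x \<bullet> i) * partial u i x\<close>.\<close>
      moreover have "0 \<le> (u x / 2 + (x \<bullet> i) * partial u i x)\<^sup>2" by simp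
      ultimately show ?thesis
        by (simp add: power2_eq_square algebra_simps)
    qed (simp add: u0)
  qed (use I1 I2 I3 in auto)
  then show ?thesis using I1 I3 by simp
qed

text \<open>If the integral were 0, then \<open>u\<close> would vanish almost everywhere; its zero
  set is closed with an open null complement, and such a complement is empty. This keeps the
  denominators of the Rayleigh quotients away from 0, where division would return the default value
  0.\<close>

lemma integral_square_pos:
  fixes u :: "'a::euclidean_space \<Rightarrow> real"
  assumes u: "u \<in> test_functions U" and U: "bounded U" and nz: "u \<noteq> (\<lambda>_. 0)"
  shows "(LINT x|lborel. (u x)\<^sup>2) > 0"
proof -
  note props = test_function_properties[OF u]
  obtain B where "U \<subseteq> cball 0 B" using bounded_subset_ballD[OF U, of 0] ball_subset_cball by (meson order_trans)
  then have I: "integrable lborel (\<lambda>x. (u x)\<^sup>2)"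
    by (intro integrable_continuous_bounded_support[where R = B])
      (auto intro!: continuous_intros props(2,4))
  have "(LINT x|lborel. (u x)\<^sup>2) \<noteq> 0"
  proof
    assume "(LINT x|lborel. (u x)\<^sup>2) = 0"
    then have ae: "AE x in lborel. x \<in> {x. u x = 0}"
      by (subst (asm) integral_nonneg_eq_0_iff_AE[OF I]) auto
    have cl: "closed {x. u x = 0}"
      by (intro closed_Collect_eq props(2) continuous_on_const)
    have "x \<in> {x. u x = 0}" for x
      by (rule mem_closed_if_AE_lebesgue_open[OF open_UNIV cl])
        (use ae AE_completion in auto)
    then show False using nz by auto
  qed
  moreover have "(LINT x|lborel. (u x)\<^sup>2) \<ge> 0" by (rule integral_nonneg_AE) simp
  ultimately show ?thesis by linarith
qed

section \<open>Positivity and finiteness of the first eigenvalue\<close>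

lemma lambda1_pos:
  fixes \<Omega> :: "'a::euclidean_space set"
  assumes "bounded \<Omega>"
  shows "lambda1 \<Omega> > 0"
proof -
  obtain B where B: "B > 0" "interior \<Omega> \<subseteq> cball 0 B"
    using assms bounded_subset_ballD[of \<Omega> 0] interior_subset ball_subset_cball by (meson order_trans)
  \<comment> \<open>The Poincare constant depends only on the enclosing ball, so it bounds all
    Rayleigh quotients at once. A strict bound on each quotient would not survive the infimum; over
    an empty family the infimum is \<infinity>.\<close>
  have "ereal (1 / (4 * B\<^sup>2)) \<le> lambda1 \<Omega>"
    unfolding lambda1_def
  proof (rule INF_greatest)
    fix u assume "u \<in> {u \<in> test_functions (interior \<Omega>). u \<noteq> (\<lambda>_. 0)}"
    then have u: "u \<in> test_functions (interior \<Omega>)" "u \<noteq> (\<lambda>_. 0)" by auto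
    show "ereal (1 / (4 * B\<^sup>2))
        \<le> ereal ((LINT x|lborel. (norm (gradient u x))\<^sup>2) / (LINT x|lborel. (u x)\<^sup>2))"
      using poincare_inequality[OF u(1) B(2)] B(1)
        integral_square_pos[OF u(1) bounded_subset[OF assms interior_subset] u(2)]
      by (simp add: field_simps)
  qed
  moreover have "0 < ereal (1 / (4 * B\<^sup>2))" using B(1) by simp
  ultimately show ?thesis by order
qed

text \<open>In the eigenvalue equation at a single point the left side is a real number, whereas an
  infinite eigenvalue times the positive \<open>\<phi> y\<close> would be infinite.\<close>

lemma ground_state_lambda1:
  assumes "bounded_domain \<Omega>" and "ground_state \<Omega> \<phi>"
  obtains l where "l > 0" and "lambda1 \<Omega> = ereal l"
proof -
  obtain y where "\<phi> y > 0" and "ereal (- laplacian \<phi> y) = lambda1 \<Omega> * ereal (\<phi> y)"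
    using assms unfolding bounded_domain_def ground_state_def by blast
  moreover have "lambda1 \<Omega> > 0"
    using assms(1) lambda1_pos by (auto simp: bounded_domain_def)
  ultimately show thesis
    using that by (cases "lambda1 \<Omega>") auto
qed

section \<open>Inverting the function \<open>beta\<close>\<close>

lemma le_beta_imp_le:
  assumes "lambda1 \<Omega> = ereal l" and "l > 0" and "\<rho> > 0" and "C > c / r\<^sup>2" and "C > 0"
    and "C \<le> beta c r \<Omega> \<rho>"
  shows "\<rho> \<le> sqrt (c / (C * l))"
proof -
  \<comment> \<open>On the constant branch the assumption would read
    \<open>C \<le> c / r\<^sup>2\<close>, against the choice of \<open>C\<close>.\<close>
  have "C \<le> c / (\<rho>\<^sup>2 * l)"
    using assms by (auto simp: beta_def split: if_splits)
  then have "\<rho>\<^sup>2 \<le> c / (C * l)"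
    using assms by (simp add: field_simps)
  then show ?thesis by (rule real_le_rsqrt)
qed

text \<open>The constant branch has a value below \<open>C\<close>, so only the other branch can
  attain \<open>C\<close>, and there the equation determines the square of \<open>\<rho>\<close>.
  Conversely, the candidate must be shown to lie on that branch.\<close>

lemma beta_eq_iff:
  assumes l: "lambda1 \<Omega> = ereal l" "l > 0" and "c > 0" "r > 0" and C: "C > c / r\<^sup>2" and "\<rho> > 0"
  shows "beta c r \<Omega> \<rho> = C \<longleftrightarrow> \<rho> = sqrt (c / (C * l))"
proof
  have "C > 0" using assms by (smt (verit) divide_pos_pos zero_less_power)
  {
    assume eq: "beta c r \<Omega> \<rho> = C"
    then have "C = c / (\<rho>\<^sup>2 * l)"
      using assms by (auto simp: beta_def split: if_splits)
    then have "c / (C * l) = \<rho>\<^sup>2"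
      using assms \<open>C > 0\<close> by (simp add: field_simps)
    then show "\<rho> = sqrt (c / (C * l))"
      using \<open>\<rho> > 0\<close> by simp
  next
    assume eq: "\<rho> = sqrt (c / (C * l))"
    \<comment> \<open>The eigenvalue cancels, and \<open>C > c / r\<^sup>2\<close> says exactly that
      the remaining \<open>sqrt (c / C)\<close> is below the threshold \<open>r\<close>.\<close>
    have "\<rho> * sqrt l = sqrt (c / C)"
      unfolding eq real_sqrt_mult[symmetric] using l by simp
    also have "c / C < r\<^sup>2"
      using C \<open>C > 0\<close> \<open>r > 0\<close> by (simp add: field_simps)
    then have "sqrt (c / C) < r"
      using \<open>r > 0\<close> real_less_lsqrt by simp
    finally have "beta c r \<Omega> \<rho> = c / (\<rho>\<^sup>2 * l)"
      using l by (simp add: beta_def)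
    moreover have "\<rho>\<^sup>2 = c / (C * l)"
      using eq assms \<open>C > 0\<close> by simp
    ultimately show "beta c r \<Omega> \<rho> = C"
      using assms \<open>C > 0\<close> by simp
  }
qed

section \<open>The distance bound at maximizers\<close>

theorem corollary2p6:
  fixes c\<^sub>0 :: real and r\<^sub>0 :: "real \<Rightarrow> real"
  assumes c0_pos: "c\<^sub>0 > 0"
    and r0_pos: "\<And>\<alpha>. \<alpha> > 0 \<Longrightarrow> r\<^sub>0 \<alpha> > 0"
    and beta_bound:
      "\<And>\<alpha> (\<Omega> :: (real ^ 'n) set) D \<phi> x.
         \<alpha> > 0 \<Longrightarrow> bounded_domain \<Omega> \<Longrightarrow> asymmetric \<alpha> \<Omega> \<Longrightarrow> bounded_domain D \<Longrightarrow>
         ground_state \<Omega> \<phi> \<Longrightarrow> rho \<Omega> \<phi> D x > 0 \<Longrightarrow>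
         lambda1 (\<Omega> - translate x D) \<le> ereal (beta c\<^sub>0 (r\<^sub>0 \<alpha>) \<Omega> (rho \<Omega> \<phi> D x)) * lambda1 \<Omega>"
  shows
    "(\<forall>\<alpha>>0. \<forall>(\<Omega> :: (real ^ 'n) set) D \<phi> C\<^sub>0.
        bounded_domain \<Omega> \<and> asymmetric \<alpha> \<Omega> \<and> bounded_domain D \<and> ground_state \<Omega> \<phi> \<and>
        C\<^sub>0 > c\<^sub>0 / (r\<^sub>0 \<alpha>)\<^sup>2 \<and> mu \<Omega> D = ereal C\<^sub>0 * lambda1 \<Omega> \<longrightarrow>
        (\<exists>!\<rho>. \<rho> > 0 \<and> beta c\<^sub>0 (r\<^sub>0 \<alpha>) \<Omega> \<rho> = C\<^sub>0) \<and>
        (\<forall>x. lambda1 (\<Omega> - translate x D) = mu \<Omega> D \<longrightarrow>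
             rho \<Omega> \<phi> D x \<le> beta_inv c\<^sub>0 (r\<^sub>0 \<alpha>) \<Omega> C\<^sub>0))
     \<and>
     (\<exists>K>0. \<forall>\<alpha>>0. \<exists>C\<^sub>1. \<forall>(\<Omega> :: (real ^ 'n) set) D \<phi> C\<^sub>0.
        bounded_domain \<Omega> \<and> asymmetric \<alpha> \<Omega> \<and> bounded_domain D \<and> ground_state \<Omega> \<phi> \<and>
        C\<^sub>0 > c\<^sub>0 / (r\<^sub>0 \<alpha>)\<^sup>2 \<and> mu \<Omega> D = ereal C\<^sub>0 * lambda1 \<Omega> \<and> C\<^sub>0 \<ge> C\<^sub>1 \<longrightarrow>
        (\<forall>x. lambda1 (\<Omega> - translate x D) = mu \<Omega> D \<longrightarrow>
             rho \<Omega> \<phi> D x \<le> K / sqrt (C\<^sub>0 * real_of_ereal (lambda1 \<Omega>))))"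
proof -
  \<comment> \<open>This is the solution of
    \<open>c\<^sub>0 / (\<rho>\<^sup>2 * \<lambda>) = C\<close> for \<open>\<rho>\<close>, with
    \<open>\<lambda>\<close> the first eigenvalue: a closed form of the inverse of
    \<open>beta\<close> at \<open>C\<close>, from which both conclusions are read off.\<close>
  define R where "R \<Omega> C = sqrt (c\<^sub>0 / (C * real_of_ereal (lambda1 \<Omega>)))" for \<Omega> :: "(real ^ 'n) set" and C
  have R: "(\<forall>\<rho>>0. beta c\<^sub>0 (r\<^sub>0 \<alpha>) \<Omega> \<rho> = C\<^sub>0 \<longleftrightarrow> \<rho> = R \<Omega> C\<^sub>0) \<and> R \<Omega> C\<^sub>0 > 0 \<and>
      (\<forall>x. lambda1 (\<Omega> - translate x D) = mu \<Omega> D \<longrightarrow> rho \<Omega> \<phi> D x \<le> R \<Omega> C\<^sub>0)"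
    if \<alpha>: "\<alpha> > 0" and H: "bounded_domain \<Omega>" "asymmetric \<alpha> \<Omega>" "bounded_domain D" "ground_state \<Omega> \<phi>"
      and C: "C\<^sub>0 > c\<^sub>0 / (r\<^sub>0 \<alpha>)\<^sup>2" and mu: "mu \<Omega> D = ereal C\<^sub>0 * lambda1 \<Omega>"
    for \<alpha> and \<Omega> D :: "(real ^ 'n) set" and \<phi> C\<^sub>0
  proof -
    obtain l where l: "lambda1 \<Omega> = ereal l" "l > 0"
      using ground_state_lambda1[OF H(1,4)] by blast
    have "C\<^sub>0 > 0"
      using C c0_pos r0_pos[OF \<alpha>] by (smt (verit) divide_pos_pos zero_less_power)
    then have Rpos: "R \<Omega> C\<^sub>0 > 0"
      using l c0_pos by (simp add: R_def)
    have "rho \<Omega> \<phi> D x \<le> R \<Omega> C\<^sub>0" if "lambda1 (\<Omega> - translate x D) = mu \<Omega> D" for x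
    \<comment> \<open>The assumed eigenvalue estimate covers only positive distances; in the other
      case the bound follows from positivity of \<open>R\<close>.\<close>
    proof (cases "rho \<Omega> \<phi> D x > 0")
      case True
      \<comment> \<open>At a maximizer the left side of the eigenvalue estimate equals
        \<open>C\<^sub>0 * l\<close>; the finite positive factor \<open>l\<close> cancels.\<close>
      have "C\<^sub>0 \<le> beta c\<^sub>0 (r\<^sub>0 \<alpha>) \<Omega> (rho \<Omega> \<phi> D x)"
        using beta_bound[OF \<alpha> H True] that mu l by simp
      then show ?thesis
        using le_beta_imp_le[OF l True C \<open>C\<^sub>0 > 0\<close>] l by (simp add: R_def)
    qed (use Rpos in linarith)
    then show ?thesis
      using Rpos beta_eq_iff[OF l c0_pos r0_pos[OF \<alpha>] C] l by (simp add: R_def)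
  qed
  have inv: "beta_inv c\<^sub>0 (r\<^sub>0 \<alpha>) \<Omega> C\<^sub>0 = R \<Omega> C\<^sub>0"
    if "\<forall>\<rho>>0. beta c\<^sub>0 (r\<^sub>0 \<alpha>) \<Omega> \<rho> = C\<^sub>0 \<longleftrightarrow> \<rho> = R \<Omega> C\<^sub>0" "R \<Omega> C\<^sub>0 > 0" for \<alpha> \<Omega> C\<^sub>0
    unfolding beta_inv_def using that by (intro the_equality) auto
  show ?thesis
  proof (intro conjI)
    show "\<forall>\<alpha>>0. \<forall>(\<Omega> :: (real ^ 'n) set) D \<phi> C\<^sub>0.
        bounded_domain \<Omega> \<and> asymmetric \<alpha> \<Omega> \<and> bounded_domain D \<and> ground_state \<Omega> \<phi> \<and>
        C\<^sub>0 > c\<^sub>0 / (r\<^sub>0 \<alpha>)\<^sup>2 \<and> mu \<Omega> D = ereal C\<^sub>0 * lambda1 \<Omega> \<longrightarrow>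
        (\<exists>!\<rho>. \<rho> > 0 \<and> beta c\<^sub>0 (r\<^sub>0 \<alpha>) \<Omega> \<rho> = C\<^sub>0) \<and>
        (\<forall>x. lambda1 (\<Omega> - translate x D) = mu \<Omega> D \<longrightarrow>
             rho \<Omega> \<phi> D x \<le> beta_inv c\<^sub>0 (r\<^sub>0 \<alpha>) \<Omega> C\<^sub>0)"
    proof (intro allI impI, elim conjE)
      fix \<alpha> :: real and \<Omega> D :: "(real ^ 'n) set" and \<phi> C\<^sub>0
      assume "\<alpha> > 0" "bounded_domain \<Omega>" "asymmetric \<alpha> \<Omega>" "bounded_domain D" "ground_state \<Omega> \<phi>"
        "C\<^sub>0 > c\<^sub>0 / (r\<^sub>0 \<alpha>)\<^sup>2" "mu \<Omega> D = ereal C\<^sub>0 * lambda1 \<Omega>"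
      note * = R[OF this]
      then have "\<exists>!\<rho>. \<rho> > 0 \<and> beta c\<^sub>0 (r\<^sub>0 \<alpha>) \<Omega> \<rho> = C\<^sub>0"
        by (intro ex1I[of _ "R \<Omega> C\<^sub>0"]) auto
      then show "(\<exists>!\<rho>. \<rho> > 0 \<and> beta c\<^sub>0 (r\<^sub>0 \<alpha>) \<Omega> \<rho> = C\<^sub>0) \<and>
        (\<forall>x. lambda1 (\<Omega> - translate x D) = mu \<Omega> D \<longrightarrow>
             rho \<Omega> \<phi> D x \<le> beta_inv c\<^sub>0 (r\<^sub>0 \<alpha>) \<Omega> C\<^sub>0)"
        using * inv by simp
    qed
    \<comment> \<open>Splitting the root isolates \<open>K = sqrt c\<^sub>0\<close>, which is chosen
      before \<alpha> and hence independent of it.\<close>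
    have RK: "R \<Omega> C\<^sub>0 = sqrt c\<^sub>0 / sqrt (C\<^sub>0 * real_of_ereal (lambda1 \<Omega>))" for \<Omega> C\<^sub>0
      by (simp add: R_def real_sqrt_divide)
    have "sqrt c\<^sub>0 > 0" using c0_pos by simp
    then show "\<exists>K>0. \<forall>\<alpha>>0. \<exists>C\<^sub>1. \<forall>(\<Omega> :: (real ^ 'n) set) D \<phi> C\<^sub>0.
        bounded_domain \<Omega> \<and> asymmetric \<alpha> \<Omega> \<and> bounded_domain D \<and> ground_state \<Omega> \<phi> \<and>
        C\<^sub>0 > c\<^sub>0 / (r\<^sub>0 \<alpha>)\<^sup>2 \<and> mu \<Omega> D = ereal C\<^sub>0 * lambda1 \<Omega> \<and> C\<^sub>0 \<ge> C\<^sub>1 \<longrightarrow>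
        (\<forall>x. lambda1 (\<Omega> - translate x D) = mu \<Omega> D \<longrightarrow>
             rho \<Omega> \<phi> D x \<le> K / sqrt (C\<^sub>0 * real_of_ereal (lambda1 \<Omega>)))"
      using R unfolding RK by blast
  qed
qed

end
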